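(* Let $a$ be a positive integer. Then for every positive integer $n>14.4a$ there exist prime numbers $p$ and $q$ such that $n<ap<\frac{3n}{2}<aq<2n$.
   Context: All inequalities are strict. *)

theory Defs
  imports Complex_Main "HOL-Computational_Algebra.Primes"
begin

end

theory Submission
  imports Defs "HOL-Number_Theory.Prime_Powers" "HOL-Analysis.Harmonic_Numbers"
begin

text \<open>
  With \<open>x = n / a > 14.4\<close> the claim asks for primes in the open intervals from \<open>x\<close> to \<open>3x/2\<close> and
  from \<open>3x/2\<close> to \<open>2x\<close>; both follow once every interval from \<open>y > 21.6\<close> to \<open>4y/3\<close> contains a prime.
  Chebyshev's combination \<open>n! \<lfloor>n/30\<rfloor>! / (\<lfloor>n/2\<rfloor>! \<lfloor>n/3\<rfloor>! \<lfloor>n/5\<rfloor>!)\<close> has a logarithm that lies between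
  \<open>\<psi>(n) - \<psi>(n/6)\<close> and \<open>\<psi>(n)\<close> and equals \<open>A n + O(log n)\<close> with \<open>A = 0.921...\<close>. So \<open>\<psi>(n)\<close> is
  asymptotically between \<open>A n\<close> and \<open>(6/5) A n\<close>, and since \<open>4/3 > 6/5\<close>, the difference
  \<open>\<psi>(4y/3) - \<psi>(y)\<close> grows linearly, whereas the proper prime powers contribute only
  \<open>O(sqrt y log y)\<close> to it. Below 20000 a chain of primes with consecutive ratios less than \<open>4/3\<close>
  suffices.
\<close>

section \<open>Chebyshev's psi function and log factorials\<close>

definition chebyshev_psi :: "nat \<Rightarrow> real" where
  "chebyshev_psi n = (\<Sum>d=1..n. mangoldt d)"

lemma chebyshev_psi_diff:
  assumes "m \<le> n"
  shows "chebyshev_psi n - chebyshev_psi m = (\<Sum>d\<in>{m<..n}. mangoldt d)"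
proof -
  have "{1..n} = {1..m} \<union> {m<..n}" using assms by auto
  then have "chebyshev_psi n = chebyshev_psi m + (\<Sum>d\<in>{m<..n}. mangoldt d)"
    unfolding chebyshev_psi_def by (simp only:) (intro sum.union_disjoint; auto)
  then show ?thesis by simp
qed

lemma chebyshev_psi_le_mult_ln:
  assumes "n \<ge> 1"
  shows "chebyshev_psi n \<le> n * ln n"
proof -
  have "chebyshev_psi n \<le> (\<Sum>d=1..n. ln (real n))"
    unfolding chebyshev_psi_def
  proof (intro sum_mono)
    fix d assume d: "d \<in> {1..n}"
    then have "mangoldt d \<le> ln (real d)" by (intro mangoldt_le) auto
    also have "\<dots> \<le> ln (real n)" using d by (subst ln_le_cancel_iff) auto
    finally show "mangoldt d \<le> ln (real n)" .
  qed
  then show ?thesis by simp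
qed

text \<open>Passing to \<open>Suc n\<close> adds \<open>ln (Suc n)\<close>, the sum of
  \<open>mangoldt\<close> over its divisors, and \<open>n div d\<close> grows by one exactly at
  those divisors. The free limit \<open>N\<close> lets factorials of different sizes share one index
  range.\<close>

lemma ln_fact_eq_sum_mangoldt:
  assumes "n \<le> N"
  shows "ln (fact n) = (\<Sum>d=1..N. mangoldt d * real (n div d))"
  using assms
proof (induction n)
  case 0
  then show ?case by simp
next
  case (Suc n)
  have "ln (fact (Suc n)) = ln (real (Suc n)) + ln (fact n :: real)"
    by (simp add: ln_mult del: of_nat_Suc)
  also have "ln (real (Suc n)) = (\<Sum>d | d dvd Suc n. mangoldt d)"
    using mangoldt_sum[of "Suc n", where ?'a = real] by simp
  also have "\<dots> = (\<Sum>d=1..N. if d dvd Suc n then mangoldt d else 0)"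
    using dvd_imp_le[of _ "Suc n"] dvd_pos_nat[of "Suc n"] order_trans[OF _ Suc.prems]
    by (intro sum.mono_neutral_cong_left) (auto simp: Suc_le_eq)
  also have "ln (fact n :: real) = (\<Sum>d=1..N. mangoldt d * real (n div d))"
    using Suc by simp
  finally show ?case
    by (simp add: sum.distrib [symmetric] div_Suc dvd_eq_mod_eq_0 algebra_simps if_distrib cong: if_cong)
qed

section \<open>Chebyshev's combination of log factorials\<close>

lemma chebyshev_coefficient:
  fixes k :: nat
  defines "c \<equiv> real k - real (k div 2) - real (k div 3) - real (k div 5) + real (k div 30)"
  shows "0 \<le> c" "c \<le> 1" "1 \<le> k \<Longrightarrow> k < 6 \<Longrightarrow> c = 1"
proof -
  define q r where "q = k div 30" and "r = k mod 30"
  \<comment> \<open>Only the residue mod 30 matters, since 30 - 15 - 10 - 6 + 1 = 0.\<close>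
  have "\<forall>r\<in>set [0..<30]. r div 2 + r div 3 + r div 5 \<le> r \<and> r \<le> r div 2 + r div 3 + r div 5 + (1 :: nat)"
    by code_simp
  moreover have "r < 30" by (simp add: r_def)
  ultimately have "r div 2 + r div 3 + r div 5 \<le> r" "r \<le> r div 2 + r div 3 + r div 5 + 1"
    by auto
  moreover have "k = 30 * q + r" by (simp add: q_def r_def)
  then have "k div 2 = 15 * q + r div 2" "k div 3 = 10 * q + r div 3" "k div 5 = 6 * q + r div 5"
    by simp_all
  ultimately have *: "k div 2 + k div 3 + k div 5 \<le> k + k div 30"
    "k + k div 30 \<le> k div 2 + k div 3 + k div 5 + 1"
    using \<open>k = 30 * q + r\<close> q_def by linarith+
  show "0 \<le> c" "c \<le> 1"
    using *[THEN of_nat_mono[where ?'a = real]] unfolding c_def by simp_all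
  assume "1 \<le> k" "k < 6"
  then have "k \<in> {1, 2, 3, 4, 5}" by auto
  then have "k + k div 30 = k div 2 + k div 3 + k div 5 + 1" by auto
  from arg_cong[OF this, of real] show "c = 1" unfolding c_def by simp
qed

definition chebyshev_combination :: "nat \<Rightarrow> real" where
  "chebyshev_combination n = ln (fact n) - ln (fact (n div 2)) - ln (fact (n div 3))
     - ln (fact (n div 5)) + ln (fact (n div 30))"

lemma chebyshev_combination_eq:
  "chebyshev_combination n = (\<Sum>d=1..n. mangoldt d * (real (n div d) - real (n div d div 2)
     - real (n div d div 3) - real (n div d div 5) + real (n div d div 30)))"
proof -
  have *: "n div d div k = n div k div d" for d k
    by (simp add: div_mult2_eq [symmetric] mult.commute)
  show ?thesis
    unfolding chebyshev_combination_def *[of _ 2] *[of _ 3] *[of _ 5] *[of _ 30]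
    using ln_fact_eq_sum_mangoldt[of n n] ln_fact_eq_sum_mangoldt[of "n div 2" n]
      ln_fact_eq_sum_mangoldt[of "n div 3" n] ln_fact_eq_sum_mangoldt[of "n div 5" n]
      ln_fact_eq_sum_mangoldt[of "n div 30" n]
    by (simp add: ring_distribs sum.distrib sum_subtractf)
qed

lemma chebyshev_combination_le_psi: "chebyshev_combination n \<le> chebyshev_psi n"
  unfolding chebyshev_combination_eq chebyshev_psi_def
  by (intro sum_mono mult_left_le chebyshev_coefficient mangoldt_nonneg)

text \<open>Beyond \<open>n div 6\<close> the quotient \<open>n div d\<close> lies in 1..5, where
  the coefficient is 1; the remaining terms are nonnegative.\<close>

lemma psi_diff_le_chebyshev_combination:
  "chebyshev_psi n - chebyshev_psi (n div 6) \<le> chebyshev_combination n"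
proof -
  let ?c = "\<lambda>k. real k - real (k div 2) - real (k div 3) - real (k div 5) + real (k div 30)"
  have "chebyshev_psi n - chebyshev_psi (n div 6) = (\<Sum>d\<in>{n div 6<..n}. mangoldt d)"
    by (rule chebyshev_psi_diff) simp
  also have "\<dots> = (\<Sum>d\<in>{n div 6<..n}. mangoldt d * ?c (n div d))"
  proof (intro sum.cong refl)
    fix d assume d: "d \<in> {n div 6<..n}"
    then have "0 < d" "d \<le> n" "n < 6 * d" by auto
    then have "1 \<le> n div d" "n div d < 6"
      by (auto simp: Suc_le_eq div_greater_zero_iff less_mult_imp_div_less)
    then show "mangoldt d = mangoldt d * ?c (n div d)"
      by (subst chebyshev_coefficient(3)) auto
  qed
  also have "\<dots> \<le> (\<Sum>d=1..n. mangoldt d * ?c (n div d))"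
    by (intro sum_mono2 mult_nonneg_nonneg mangoldt_nonneg chebyshev_coefficient) auto
  finally show ?thesis unfolding chebyshev_combination_eq .
qed

section \<open>Stirling-type bounds\<close>

text \<open>This is ln t \<le> t - 1 at t = x / y. Applied in both orders of its arguments, it
  controls the increments of t ln t.\<close>

lemma diff_le_mult_ln_diff:
  fixes x y :: real
  assumes "x > 0" "y > 0"
  shows "y - x \<le> y * (ln y - ln x)"
proof -
  have "ln (x / y) \<le> x / y - 1" using assms by (intro ln_le_minus_one) simp
  then have "y * (ln x - ln y) \<le> y * (x / y - 1)"
    using assms by (intro mult_left_mono) (simp_all add: ln_div)
  also have "\<dots> = x - y" using assms by (simp add: field_simps)
  finally show ?thesis by (simp add: algebra_simps)
qed

lemma ln_fact_bounds_nat: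
  assumes "n \<ge> 1"
  shows "n * ln n - n + 1 \<le> ln (fact n)" "ln (fact n) \<le> n * ln n - n + 1 + ln n"
  using assms
proof (induction n rule: dec_induct)
  case base
  { case 1 then show ?case by simp next case 2 then show ?case by simp }
next
  case (step n)
  have S: "ln (fact (Suc n)) = ln (real n + 1) + ln (fact n :: real)"
    by (simp add: ln_mult add.commute)
  have n: "real n > 0" using step by simp
  \<comment> \<open>By \<open>lo\<close> the lower bound grows by at most \<open>ln (n + 1)\<close>
    from \<open>n\<close> to \<open>n + 1\<close>; by \<open>up\<close> the upper bound grows by at
    least that much.\<close>
  have lo: "real n - (real n + 1) \<le> n * (ln n - ln (real n + 1))"
    and up: "(real n + 1) - n \<le> (real n + 1) * (ln (real n + 1) - ln n)"
    using n by (intro diff_le_mult_ln_diff; simp)+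
  have c: "real (Suc n) = real n + 1" by simp
  { case 1 show ?case using step.IH(1) step.hyps lo unfolding S c by (simp add: algebra_simps)
  next case 2 show ?case using step.IH(2) step.hyps up unfolding S c by (simp add: algebra_simps) }
qed

text \<open>For t \<ge> 1 the function t ln t - t increases, and by at most ln x between
  \<open>n\<close> and \<open>x\<close>; the latter costs the term \<open>- ln x\<close> in the
  lower bound.\<close>

lemma ln_fact_bounds:
  fixes x :: real
  assumes "1 \<le> x" "real n \<le> x" "x < real n + 1"
  shows "x * ln x - x + 1 - ln x \<le> ln (fact n)" "ln (fact n) \<le> x * ln x - x + 1 + ln x"
proof -
  have n: "n \<ge> 1" using assms by linarith
  have "x - n \<le> x * (ln x - ln n)" "n - x \<le> n * (ln n - ln x)"
    using assms n by (intro diff_le_mult_ln_diff; simp)+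
  moreover have "(x - n) * ln n \<ge> 0" "(n + 1 - x) * ln x \<ge> 0"
    using assms n by (intro mult_nonneg_nonneg; simp)+
  moreover have "ln n \<le> ln x" using assms n by simp
  ultimately show "x * ln x - x + 1 - ln x \<le> ln (fact n)" "ln (fact n) \<le> x * ln x - x + 1 + ln x"
    using ln_fact_bounds_nat[OF n] by (simp_all add: algebra_simps)
qed

lemma ln_fact_div_bounds:
  fixes n k :: nat
  assumes "k > 0" "k \<le> n"
  shows "n / k * (ln n - ln k) - n / k + 1 - ln n \<le> ln (fact (n div k))"
    "ln (fact (n div k)) \<le> n / k * (ln n - ln k) - n / k + 1 + ln n"
proof -
  have x: "1 \<le> real n / k" "real (n div k) \<le> real n / k" "real n / k < real (n div k) + 1"
    using assms floor_divide_of_nat_eq[of n k, where ?'a = real]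
      of_int_floor_le[of "real n / k"] floor_correct[of "real n / k"] by simp_all
  have l: "ln (real n / k) = ln n - ln k" using assms by (simp add: ln_div)
  \<comment> \<open>This weakens the error ln (n / k) to \<open>ln n\<close>, which is the same for
    every \<open>k\<close>.\<close>
  have "ln (real k) \<ge> 0" using assms by simp
  with ln_fact_bounds[OF x] show 
    "n / k * (ln n - ln k) - n / k + 1 - ln n \<le> ln (fact (n div k))"
    "ln (fact (n div k)) \<le> n / k * (ln n - ln k) - n / k + 1 + ln n"
    unfolding l by linarith+
qed

section \<open>Chebyshev's constant\<close>

lemma exp_1_gt_27: "exp 1 > (27/10 :: real)"
proof -
  have "(27/10 :: real) < (1 + 1 / real 100) ^ 100" by (simp add: power_divide field_simps)
  also have "\<dots> \<le> exp 1" by (rule exp_ge_one_plus_x_over_n_power_n) auto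
  finally show ?thesis .
qed

definition chebyshev_const :: real where
  "chebyshev_const = ln 2 / 2 + ln 3 / 3 + ln 5 / 5 - ln 30 / 30"

text \<open>Multiplying by 30 clears the denominators and gives \<open>ln ?X\<close>. The bounds
  become e^55 \<le> X^2 and X \<le> e^28, which follow from 2.7 < e < 2.72 by integer
  arithmetic.\<close>

lemma chebyshev_const_bounds: "11 / 12 \<le> chebyshev_const" "chebyshev_const \<le> 14 / 15"
proof -
  let ?X = "2 ^ 14 * 3 ^ 9 * 5 ^ 5 :: real"
  have "ln (30::real) = ln (2 * 3 * 5)" by simp
  also have "\<dots> = ln 2 + ln 3 + ln 5" by (simp only: ln_mult_pos zero_less_numeral mult_pos_pos)
  finally have "30 * chebyshev_const = 14 * ln 2 + 9 * ln 3 + 5 * ln 5"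
    unfolding chebyshev_const_def by (simp add: field_simps)
  also have "\<dots> = ln ?X" 
    by (simp only: ln_mult_pos zero_less_numeral zero_less_power mult_pos_pos ln_realpow of_nat_numeral)
  finally have X: "30 * chebyshev_const = ln ?X" .
  have "exp (55 :: real) = exp 1 ^ 55" by (simp add: exp_of_nat_mult [symmetric])
  also have "\<dots> \<le> (272/100) ^ 55" using e_less_272 by (intro power_mono) auto
  also have "\<dots> \<le> ?X ^ 2" by (simp add: power_divide)
  finally have "55 \<le> ln (?X ^ 2)" by (subst ln_ge_iff) auto
  also have "ln (?X ^ 2) = 2 * ln ?X" by (subst ln_realpow) auto
  finally show "11 / 12 \<le> chebyshev_const" using X by simp
  have "?X \<le> (27/10) ^ 28" by (simp add: power_divide)
  also have "\<dots> \<le> exp 1 ^ 28" using exp_1_gt_27 by (intro power_mono) auto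
  also have "\<dots> = exp (28 :: real)" by (simp add: exp_of_nat_mult [symmetric])
  finally have "ln ?X \<le> ln (exp 28)" by (subst ln_le_cancel_iff) auto
  then show "chebyshev_const \<le> 14 / 15" using X by simp
qed

text \<open>As 1 - 1/2 - 1/3 - 1/5 + 1/30 = 0, the terms in n ln n and n cancel, leaving
  \<open>chebyshev_const * n\<close>. The constants add up to -1, and each of the five factorials
  has an error of at most \<open>ln n\<close>.\<close>

lemma chebyshev_combination_bounds:
  assumes "n \<ge> 30"
  shows "chebyshev_const * n - 1 - 5 * ln n \<le> chebyshev_combination n"
    "chebyshev_combination n \<le> chebyshev_const * n + 5 * ln n"
proof -
  note b = ln_fact_div_bounds[of 1 n] ln_fact_div_bounds[of 2 n] ln_fact_div_bounds[of 3 n]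
    ln_fact_div_bounds[of 5 n] ln_fact_div_bounds[of 30 n]
  show "chebyshev_const * n - 1 - 5 * ln n \<le> chebyshev_combination n"
    "chebyshev_combination n \<le> chebyshev_const * n + 5 * ln n"
    using b assms unfolding chebyshev_combination_def chebyshev_const_def
    by (simp_all add: algebra_simps)
qed

section \<open>Linear bounds for psi\<close>

text \<open>This is ln t \<le> t - 1 at t = x / 2^k; the choice of \<open>k\<close> trades slope
  against intercept.\<close>

lemma ln_le_linear:
  fixes x :: real
  assumes "x > 0"
  shows "ln x \<le> x / 2 ^ k + k * (25 / 36) - 1"
proof -
  have "ln (x / 2 ^ k) \<le> x / 2 ^ k - 1" using assms by (intro ln_le_minus_one) simp
  moreover have "ln (x / 2 ^ k) = ln x - k * ln 2" using assms by (simp add: ln_div ln_realpow)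
  moreover have "k * ln 2 \<le> k * (25 / 36)" using ln2_le_25_over_36 by (intro mult_left_mono) auto
  ultimately show ?thesis by linarith
qed

lemma chebyshev_psi_lower:
  assumes "n \<ge> 30"
  shows "11 / 12 * n - 1 - 5 * ln n \<le> chebyshev_psi n"
proof -
  have "11 / 12 * real n \<le> chebyshev_const * n"
    using chebyshev_const_bounds by (intro mult_right_mono) auto
  with chebyshev_combination_bounds(1)[OF assms] chebyshev_combination_le_psi[of n]
  show ?thesis by linarith
qed

text \<open>The slope s = 29/25 solves s = 14/15 + 1/30 + s/6, so only the additive constant
  changes, by \<open>e\<close>.\<close>

lemma chebyshev_psi_step:
  assumes "n \<ge> 30" "chebyshev_psi (n div 6) \<le> 29 / 25 * real (n div 6) + c"
    and "5 * ln n \<le> n / 30 + e"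
  shows "chebyshev_psi n \<le> 29 / 25 * n + (c + e)"
proof -
  have "chebyshev_const * n \<le> 14 / 15 * n"
    using chebyshev_const_bounds by (intro mult_right_mono) auto
  moreover have "real (n div 6) \<le> n / 6"
    using floor_divide_of_nat_eq[of n 6, where ?'a = real] by linarith
  ultimately show ?thesis
    using assms psi_diff_le_chebyshev_combination[of n] chebyshev_combination_bounds(2)[of n]
    by linarith
qed

text \<open>
  For \<open>n \<ge> 1296\<close> the logarithmic error is absorbed by the linear term, so the additive constant
  only grows along the first three steps of the recursion from \<open>n\<close> to \<open>n div 6\<close>.
\<close>

lemma chebyshev_psi_upper: "chebyshev_psi n \<le> 29 / 25 * n + 200"
proof -
  have base: "chebyshev_psi n \<le> 29 / 25 * n + 150" if "n < 36" for n
  proof (cases "n = 0")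
    case False
    have "ln (real n) \<le> 4" using ln_le_linear[of "real n" 5] that False by simp
    then have "n * ln n \<le> 36 * 4" using that False by (intro mult_mono) auto
    with chebyshev_psi_le_mult_ln[of n] False show ?thesis by simp
  qed (simp add: chebyshev_psi_def)
  \<comment> \<open>Here 5/256 < 1/30, and the intercept is just below 23. The constants are thus
    150, 150 + 23 = 173 and 173 + 23 = 196, rounded up to 200.\<close>
  have ln: "5 * ln n \<le> n / 30 + 23" if "n > 0" for n :: nat
    using ln_le_linear[of "real n" 8] that by simp
  have mid: "chebyshev_psi n \<le> 29 / 25 * n + 173" if "n < 216" for n
  proof (cases "n < 36")
    case True
    with base[of n] show ?thesis by simp
  next
    case False
    with chebyshev_psi_step[of n, OF _ base ln] that show ?thesis by simp
  qed
  have small: "chebyshev_psi n \<le> 29 / 25 * n + 200" if "n < 1296" for n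
  proof (cases "n < 36")
    case True
    with base[of n] show ?thesis by simp
  next
    case False
    moreover have "n div 6 < 216" using that by simp
    ultimately show ?thesis using chebyshev_psi_step[of n, OF _ mid ln] by simp
  qed
  show ?thesis
  proof (induction n rule: less_induct)
    case (less n)
    show ?case
    proof (cases "n < 1296")
      case False
      then have "5 * ln (real n) \<le> n / 30 + 0" using ln_le_linear[of "real n" 10] by simp
      with chebyshev_psi_step[of n 200 0] less False show ?thesis by simp
    qed (rule small)
  qed
qed

section \<open>Primes from the growth of psi\<close>

text \<open>Only powers p^k with k \<ge> 2 contribute, so p \<le> sqrt n. As
  \<open>n < 2 * m\<close>, at most one power of each p lies in the range, which leaves at most sqrt
  n terms of size at most ln (sqrt n).\<close>

lemma sum_mangoldt_le_if_no_prime: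
  assumes no_prime: "\<And>p. m < p \<Longrightarrow> p \<le> n \<Longrightarrow> \<not> prime p" and "n < 2 * m"
  shows "(\<Sum>d\<in>{m<..n}. mangoldt d) \<le> sqrt n * ln (sqrt n)"
proof -
  define S where "S = {d \<in> {m<..n}. primepow d}"
  have [simp]: "finite S" by (simp add: S_def)
  have n: "n > 0" if "d \<in> S" for d using that by (auto simp: S_def)
  have decomp: "\<exists>p k. prime p \<and> k \<ge> 2 \<and> d = p ^ k \<and> aprimedivisor d = p" if "d \<in> S" for d
  proof -
    from that have "primepow d" by (simp add: S_def)
    then obtain p k where pk: "prime p" "k > 0" "d = p ^ k" by (auto simp: primepow_def)
    then have "k \<noteq> 1" using no_prime[of d] that by (auto simp: S_def)
    then show ?thesis using pk by (intro exI[of _ p] exI[of _ k]) (auto simp: aprimedivisor_prime_power)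
  qed
  have bound: "aprimedivisor d \<ge> 1 \<and> real (aprimedivisor d) \<le> sqrt n" if d: "d \<in> S" for d
  proof -
    obtain p k where pk: "prime p" "k \<ge> 2" "d = p ^ k" "aprimedivisor d = p"
      using decomp[OF d] by blast
    have p: "p \<ge> 1" using pk(1) prime_ge_1_nat by blast
    then have "p ^ 2 \<le> d" unfolding pk(3) using pk(2) by (intro power_increasing) auto
    also have "d \<le> n" using d by (simp add: S_def)
    finally have "real p ^ 2 \<le> real n" by (metis of_nat_le_iff of_nat_power)
    then show ?thesis using pk p by (simp add: real_le_rsqrt)
  qed
  have "inj_on aprimedivisor S"
  proof (rule inj_onI)
    fix x y assume xy: "x \<in> S" "y \<in> S" "aprimedivisor x = aprimedivisor y"
    obtain p j where j: "prime p" "x = p ^ j" "aprimedivisor x = p" using decomp[OF xy(1)] by blast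
    obtain q k where k: "y = q ^ k" "aprimedivisor y = q" using decomp[OF xy(2)] by blast
    have q: "q = p" using xy j k by simp
    have p2: "p \<ge> 2" using j(1) prime_ge_2_nat by blast
    have gap: "\<not> i < l" if "p ^ i \<in> S" "p ^ l \<in> S" for i l
    proof
      assume "i < l"
      have "2 * m < 2 * p ^ i" using that by (simp add: S_def)
      also have "\<dots> \<le> p ^ Suc i" using p2 by simp
      also have "\<dots> \<le> p ^ l" using \<open>i < l\<close> p2 by (intro power_increasing) auto
      also have "\<dots> \<le> n" using that by (simp add: S_def)
      finally show False using assms by simp
    qed
    have "j = k" using gap[of j k] gap[of k j] xy j k q by auto
    then show "x = y" using j k q by simp
  qed
  then have "card S = card (aprimedivisor ` S)" by (simp add: card_image)
  also have "\<dots> \<le> card {1..nat \<lfloor>sqrt n\<rfloor>}"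
    using bound by (intro card_mono) (auto simp: le_nat_floor)
  finally have card: "real (card S) \<le> sqrt n" by (simp add: le_nat_iff) linarith
  have "(\<Sum>d\<in>{m<..n}. mangoldt d) = (\<Sum>d\<in>S. ln (real (aprimedivisor d)))"
    unfolding S_def by (intro sum.mono_neutral_cong_right) (auto simp: mangoldt_def)
  also have "\<dots> \<le> (\<Sum>d\<in>S. ln (sqrt n))"
  proof (intro sum_mono)
    fix d assume "d \<in> S"
    from bound[OF this] n[OF this] show "ln (real (aprimedivisor d)) \<le> ln (sqrt n)"
      by (subst ln_le_cancel_iff) auto
  qed
  also have "\<dots> = card S * ln (sqrt n)" by simp
  also have "\<dots> \<le> sqrt n * ln (sqrt n)"
    using card by (cases "n = 0") (auto intro!: mult_right_mono simp: ln_sqrt)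
  finally show ?thesis .
qed

lemma prime_between_large:
  fixes m :: nat
  assumes m: "m \<ge> 20000"
  shows "\<exists>p. prime p \<and> m < p \<and> 3 * p < 4 * m"
proof (rule ccontr)
  assume contra: "\<not> ?thesis"
  \<comment> \<open>The largest \<open>n\<close> with \<open>3 * n < 4 * m\<close>.\<close>
  define n where "n = (4 * m - 1) div 3"
  have n: "3 * n < 4 * m" "4 * m \<le> 3 * n + 3" "m \<le> n" "n < 2 * m" "n \<ge> 25600"
    using m unfolding n_def by linarith+
  define s where "s = sqrt n"
  have s2: "s * s = n" by (simp add: s_def)
  have s: "s \<ge> 160" using n(5) by (simp add: s_def real_le_rsqrt)
  have "real (4 * m) \<le> real (3 * n + 3)" using n(2) of_nat_le_iff by blast
  moreover have "real (3 * n) < real (4 * m)" using n(1) of_nat_less_iff by blast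
  ultimately have mn: "4 * real m \<le> 3 * (s * s) + 3" "3 * (s * s) < 4 * m" by (simp_all add: s2)
  have "11 / 12 * (s * s) - 1 - 5 * ln n \<le> chebyshev_psi n"
    using chebyshev_psi_lower[of n] n s2 by simp
  moreover have "ln n = 2 * ln s" using n by (simp add: s_def ln_sqrt)
  moreover have "chebyshev_psi n - chebyshev_psi m \<le> s * ln s"
    unfolding chebyshev_psi_diff[OF n(3)] s_def
  proof (rule sum_mangoldt_le_if_no_prime)
    fix p assume "m < p" "p \<le> n"
    then show "\<not> prime p" using contra n(1) by auto
  qed (rule n)
  moreover have "chebyshev_psi m \<le> 29 / 25 * m + 200" by (rule chebyshev_psi_upper)
  ultimately have "11 / 12 * (s * s) - 29 / 25 * m \<le> 201 + (s + 10) * ln s"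
    by (simp add: algebra_simps)
  moreover have "ln s \<le> s / 2 ^ 7 + 7 * (25 / 36) - 1"
    using ln_le_linear[of s 7] s by simp
  then have "ln s \<le> s / 128 + 4" by simp
  then have "(s + 10) * ln s \<le> (s + 10) * (s / 128 + 4)" using s by (intro mult_left_mono) auto
  \<comment> \<open>From \<open>mn\<close>, 29/25 m \<le> 87/100 (s^2 + 1), and 11/12 - 87/100 =
    7/150. Even after subtracting s^2/128, the quadratic term beats the linear one when s \<ge>
    160.\<close>
  moreover have "160 * s \<le> s * s" using s by (intro mult_right_mono) auto
  ultimately have "11 / 12 * (s * s) - 29 / 25 * m \<le> 241 + s * s / 128 + 4 * s + 10 * s / 128"
    by (simp add: algebra_simps add_divide_distrib)
  with \<open>160 * s \<le> s * s\<close> show False using mn s by linarith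
qed

section \<open>The finite range\<close>

lemma prime_if_no_small_divisor:
  fixes p r :: nat
  assumes "1 < p" "p < r * r" "list_all (\<lambda>k. p mod k \<noteq> 0) [2..<r]"
  shows "prime p"
proof (rule ccontr)
  assume "\<not> prime p"
  then obtain a where a: "a dvd p" "a \<noteq> 1" "a \<noteq> p"
    using \<open>1 < p\<close> by (auto simp: prime_nat_iff)
  then obtain b where b: "p = a * b" by blast
  have ab: "1 < a" "1 < b" using a b \<open>1 < p\<close> by (auto simp: nat_neq_iff)
  have "a < r \<or> b < r" using assms(2) b by (meson leI mult_le_mono not_le)
  moreover have "p mod a = 0" "p mod b = 0" using b by simp_all
  moreover have "\<forall>k\<in>{2..<r}. p mod k \<noteq> 0" using assms(3) unfolding list_all_iff set_upt .
  moreover have "a \<in> {2..<r}" if "a < r" using that ab by simp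
  moreover have "b \<in> {2..<r}" if "b < r" using that ab by simp
  ultimately show False by metis
qed

text \<open>The first chain element above \<open>m\<close> works: its predecessor is at most
  \<open>m\<close>.\<close>

lemma prime_in_chain:
  fixes m :: nat
  assumes "successively (\<lambda>p q. 3 * q < 4 * p) (l # ps)" "\<forall>p\<in>set ps. prime p"
    and "l \<le> m" "m < last (l # ps)"
  shows "\<exists>p. prime p \<and> m < p \<and> 3 * p < 4 * m"
  using assms
proof (induction ps arbitrary: l)
  case (Cons p ps)
  show ?case
  proof (cases "m < p")
    case True
    then show ?thesis using Cons.prems by (intro exI[of _ p]) auto
  next
    case False
    then show ?thesis using Cons.prems by (intro Cons.IH[of p]) auto
  qed
qed simp

lemma prime_between:
  fixes m :: nat
  assumes "m \<ge> 22"
  shows "\<exists>p. prime p \<and> m < p \<and> 3 * p < 4 * m"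
proof (cases "m \<ge> 20000")
  case True
  then show ?thesis by (rule prime_between_large)
next
  case False
  \<comment> \<open>Each prime is paired with a bound exceeding its square root, up to which trial division is done.\<close>
  define prs :: "(nat \<times> nat) list" where "prs = [
    (23, 5), (29, 6), (37, 7), (47, 7), (61, 8), (79, 9),
    (103, 11), (137, 12), (181, 14), (241, 16), (317, 18), (421, 21),
    (557, 24), (739, 28), (983, 32), (1307, 37), (1741, 42), (2311, 49),
    (3079, 56), (4099, 65), (5449, 74), (7253, 86), (9661, 99), (12853, 114),
    (17137, 131), (20011, 142)]"
  define ps where "ps = map fst prs"
  have "\<forall>(p, r)\<in>set prs. 1 < p \<and> p < r * r \<and> list_all (\<lambda>k. p mod k \<noteq> 0) [2..<r]"
    unfolding prs_def by simp
  then have "\<forall>p\<in>set ps. prime p" unfolding ps_def using prime_if_no_small_divisor by fastforce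
  moreover have "successively (\<lambda>p q. 3 * q < 4 * p) (22 # ps)" "last (22 # ps) = 20011"
    by (simp_all add: ps_def prs_def)
  ultimately show ?thesis using prime_in_chain[of 22 ps m] assms False by simp
qed

section \<open>Real intervals and conclusion\<close>

text \<open>The threshold is 3/2 * 14.4, so that 3x/2 is covered for all x > 14.4.\<close>

lemma prime_between_real:
  fixes x :: real
  assumes "x > 21.6"
  shows "\<exists>p :: nat. prime p \<and> x < p \<and> 3 * p < 4 * x"
proof (cases "x < 22")
  case True
  have "prime (23 :: nat)" by simp
  with True assms show ?thesis by (intro exI[of _ 23]) simp
next
  case False
  define m where "m = nat \<lfloor>x\<rfloor>"
  have m: "real m \<le> x" "x < real m + 1" using False unfolding m_def by linarith+
  then have "m \<ge> 22" using False unfolding m_def by linarith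
  then obtain p where p: "prime p" "m < p" "3 * p < 4 * m" using prime_between by blast
  from p(2,3) have "real m + 1 \<le> p" "3 * real p < 4 * m" by linarith+
  with m p(1) show ?thesis by (intro exI[of _ p]) auto
qed

theorem theorem6p4:
  fixes a n :: nat
  assumes "a > 0" and "n > 0" and "real n > 14.4 * real a"
  shows "\<exists>p q :: nat. prime p \<and> prime q \<and>
           real n < real (a * p) \<and> real (a * p) < 3 * real n / 2 \<and>
           3 * real n / 2 < real (a * q) \<and> real (a * q) < 2 * real n"
proof -
  define x where "x = real n / real a"
  have n: "real n = a * x" using assms by (simp add: x_def)
  have x: "x > 14.4" using assms by (simp add: x_def field_simps)
  have "\<exists>p :: nat. prime p \<and> x < p \<and> p < 3 * x / 2"
  proof -
    \<comment> \<open>Below 21.6 \<open>prime_between_real\<close> does not apply to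
      \<open>x\<close> itself; there 17 < 3/2 * 14.4 and 23 < 3/2 * 17 serve as witnesses.\<close>
    consider "x < 17" | "17 \<le> x" "x < 23" | "x \<ge> 23" by linarith
    then show ?thesis
    proof cases
      case 1
      have "prime (17 :: nat)" by simp
      with 1 x show ?thesis by (intro exI[of _ 17]) simp
    next
      case 2
      have "prime (23 :: nat)" by simp
      with 2 show ?thesis by (intro exI[of _ 23]) simp
    next
      case 3
      then obtain p :: nat where "prime p" "x < p" "3 * p < 4 * x"
        using prime_between_real[of x] by auto
      with 3 show ?thesis by (intro exI[of _ p]) simp
    qed
  qed
  then obtain p :: nat where p: "prime p" "x < p" "p < 3 * x / 2" by blast
  \<comment> \<open>The ratio 4/3 is exactly that of 2x to 3x/2.\<close>
  obtain q :: nat where q: "prime q" "3 * x / 2 < q" "3 * q < 4 * (3 * x / 2)"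
    using prime_between_real[of "3 * x / 2"] x by auto
  have "a * x < a * real p" "a * real p < a * (3 * x / 2)"
    "a * (3 * x / 2) < a * real q" "a * real q < a * (2 * x)"
    using p q assms(1) by (intro mult_strict_left_mono; simp)+
  then have "real n < real (a * p)" "real (a * p) < 3 * real n / 2"
    "3 * real n / 2 < real (a * q)" "real (a * q) < 2 * real n"
    unfolding n by simp_all
  with p(1) q(1) show ?thesis by blast
qed

end
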